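(* Let $\{z_t\},\{y_t\},\{x_t\}$ be generated by the AC-FGM algorithm (see context) applied to $\min_{x\in X}\{\Psi(x)=f(x)+h(x)\}$ with $f$ smooth, with $x_0=y_0=z_0\in X$, $\eta_1>0$ such that $x_1\ne x_0$, $\beta_1=0$, $\beta_t=\beta$ for $t\ge2$ with $\beta\in(0,1-\tfrac{\sqrt6}{3}]$, $\tau_1=0$, $\tau_t=\tfrac t2$ for $t\ge 2$, and stepsizes $$\eta_2=\min\{(1-\beta)\eta_1,\tfrac1{4L_1}\},\qquad \eta_3=\min\{\eta_2,\tfrac1{4L_2}\},\qquad \eta_t=\min\{\tfrac{t}{t-1}\eta_{t-1},\tfrac{t-1}{8L_{t-1}}\}\ \ (t\ge4),$$ where the $L_t$ are the local estimates defined in the context. Then for all $t\ge2$, $$\eta_t\ge\frac{t}{12\hat L_{t-1}},\qquad\text{where }\ \hat L_t:=\max\Big\{\tfrac{1}{4(1-\beta)\eta_1},L_1,\dots,L_t\Big\}.$$ Consequently, for every $x^*\in X^*$ and every $k\ge1$, $$\Psi(x_k)-\Psi(x^* )\le\frac{12\hat L_k}{k(k+1)}\Big[\tfrac1\beta\|z_0-x^*\|^2+\eta_2\Big(\tfrac{5L_1}{2}-\tfrac1{\eta_1}\Big)\|z_1-z_0\|^2\Big]$$ and $$\Psi(\bar x_k)-\Psi(x^* )\le\frac{1}{\sum_{t=2}^{k+1}\frac{t}{6\hat L_{t-1}}}\Big[\tfrac1\beta\|z_0-x^*\|^2+\eta_2\Big(\tfrac{5L_1}{2}-\tfrac1{\eta_1}\Big)\|z_1-z_0\|^2\Big],$$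 where $$\bar x_k:=\frac{\sum_{t=1}^{k-1}\big[(\tau_t+1)\eta_{t+1}-\tau_{t+1}\eta_{t+2}\big]x_t+(\tau_k+1)\eta_{k+1}x_k}{\sum_{t=2}^{k+1}\eta_t}.$$
   Context: Problem: $X\subseteq\mathbb{R}^n$ is a nonempty closed convex set, $h:X\to\mathbb{R}$ and $f:X\to\mathbb{R}$ are closed convex functions, $\Psi:=f+h$, and the set $X^*$ of minimizers of $\Psi$ over $X$ is nonempty. $\langle\cdot,\cdot\rangle$ is the Euclidean inner product and $\|\cdot\|$ the Euclidean norm. For $x\in X$, $g(x)\in\partial f(x)$ denotes the (sub)gradient returned by the first-order oracle. $f$ is smooth: there is $L>0$ (unknown to the algorithm) such that for all $x,y\in X$, $\|g(x)-g(y)\|\le L\|x-y\|$ and $$\tfrac{1}{2L}\|g(y)-g(x)\|^2\le f(y)-f(x)-\langle g(x),y-x\rangle\le\tfrac L2\|y-x\|^2 .$$ AC-FGM algorithm: starting from $z_0=y_0=x_0\in X$, for $t=1,2,\dots$ $$z_t=\arg\min_{z\in X}\big\{\eta_t[\langle g(x_{t-1}),z\rangle+h(z)]+\tfrac12\|y_{t-1}-z\|^2\big\},$$ $$y_t=(1-\beta_t)y_{t-1}+\beta_tz_t,\qquad x_t=\frac{z_t+\tau_tx_{t-1}}{1+\tau_t}.$$ The parameters may depend on previously generated iterates. Local estimates: $L_1:=\|g(x_1)-g(x_0)\|/\|x_1-x_0\|$ (with $\eta_1$ chosen such that $x_1\ne x_0$). For $t\ge2$, with $B_t:=f(x_{t-1})-f(x_t)-\langle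 g(x_t),x_{t-1}-x_t\rangle\ (\ge 0)$, set $L_t:=0$ if $B_t=0$ and $L_t:=\|g(x_t)-g(x_{t-1})\|^2/(2B_t)$ if $B_t>0$. Conventions: $\tfrac00=0$ and $\tfrac a0=+\infty$ for $a>0$. *)

theory Defs
  imports "HOL-Analysis.Analysis"
begin

text \<open>A function \<open>X \<rightarrow> \<real>\<close> is represented by a total function of which only the values on \<open>X\<close>
  matter; closedness refers to its epigraph over \<open>X\<close>.\<close>

definition closed_convex_on :: "(real ^ 'n) set \<Rightarrow> (real ^ 'n \<Rightarrow> real) \<Rightarrow> bool" where
  "closed_convex_on X f \<longleftrightarrow> convex_on X f \<and> closed (epigraph X f)"

definition subdifferential :: "(real ^ 'n) set \<Rightarrow> (real ^ 'n \<Rightarrow> real) \<Rightarrow> real ^ 'n \<Rightarrow> (real ^ 'n) set" where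
  "subdifferential X f x = {v. \<forall>y\<in>X. f y \<ge> f x + v \<bullet> (y - x)}"

definition minimizers :: "(real ^ 'n) set \<Rightarrow> (real ^ 'n \<Rightarrow> real) \<Rightarrow> (real ^ 'n) set" where
  "minimizers X F = {x. is_arg_min F (\<lambda>u. u \<in> X) x}"

definition bregman_gap ::
    "(real ^ 'n \<Rightarrow> real) \<Rightarrow> (real ^ 'n \<Rightarrow> real ^ 'n) \<Rightarrow> real ^ 'n \<Rightarrow> real ^ 'n \<Rightarrow> real" where
  "bregman_gap f g x y = f y - f x - g x \<bullet> (y - x)"

definition smooth_with ::
    "(real ^ 'n) set \<Rightarrow> (real ^ 'n \<Rightarrow> real) \<Rightarrow> (real ^ 'n \<Rightarrow> real ^ 'n) \<Rightarrow> real \<Rightarrow> bool" where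
  "smooth_with X f g L \<longleftrightarrow> (\<forall>x\<in>X. \<forall>y\<in>X.
      norm (g x - g y) \<le> L * norm (x - y) \<and>
      1 / (2 * L) * (norm (g y - g x))\<^sup>2 \<le> bregman_gap f g x y \<and>
      bregman_gap f g x y \<le> L / 2 * (norm (y - x))\<^sup>2)"

text \<open>The parameter sequences are arbitrary here, so they may depend on the iterates.\<close>

definition ac_fgm ::
    "(real ^ 'n) set \<Rightarrow> (real ^ 'n \<Rightarrow> real) \<Rightarrow> (real ^ 'n \<Rightarrow> real ^ 'n) \<Rightarrow>
     (nat \<Rightarrow> real) \<Rightarrow> (nat \<Rightarrow> real) \<Rightarrow> (nat \<Rightarrow> real) \<Rightarrow>
     (nat \<Rightarrow> real ^ 'n) \<Rightarrow> (nat \<Rightarrow> real ^ 'n) \<Rightarrow> (nat \<Rightarrow> real ^ 'n) \<Rightarrow> bool" where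
  "ac_fgm X h g \<eta> \<beta> \<tau> z y x \<longleftrightarrow>
     z 0 = x 0 \<and> y 0 = x 0 \<and> x 0 \<in> X \<and>
     (\<forall>t\<ge>1.
        is_arg_min
          (\<lambda>u. \<eta> t * (g (x (t - 1)) \<bullet> u + h u) + 1 / 2 * (norm (y (t - 1) - u))\<^sup>2)
          (\<lambda>u. u \<in> X) (z t) \<and>
        y t = (1 - \<beta> t) *\<^sub>R y (t - 1) + \<beta> t *\<^sub>R z t \<and>
        x t = (1 / (1 + \<tau> t)) *\<^sub>R (z t + \<tau> t *\<^sub>R x (t - 1)))"

text \<open>Only the values at \<open>t \<ge> 1\<close> are meaningful.\<close>

definition local_est ::
    "(real ^ 'n \<Rightarrow> real) \<Rightarrow> (real ^ 'n \<Rightarrow> real ^ 'n) \<Rightarrow> (nat \<Rightarrow> real ^ 'n) \<Rightarrow> nat \<Rightarrow> real" where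
  "local_est f g x t =
     (if t = 1 then norm (g (x 1) - g (x 0)) / norm (x 1 - x 0)
      else let B = bregman_gap f g (x t) (x (t - 1)) in
        if B = 0 then 0 else (norm (g (x t) - g (x (t - 1))))\<^sup>2 / (2 * B))"

definition max_est :: "real \<Rightarrow> real \<Rightarrow> (nat \<Rightarrow> real) \<Rightarrow> nat \<Rightarrow> real" where
  "max_est b \<eta>1 L t = Max (insert (1 / (4 * (1 - b) * \<eta>1)) (L ` {1..t}))"

text \<open>The quotients by local estimates are taken in the extended reals, where
  \<open>0 / 0 = 0\<close> and \<open>a / 0 = \<infinity>\<close> for \<open>a > 0\<close>; thus a vanishing estimate imposes no
  upper bound on the stepsize.\<close>

definition stepsize_rule :: "real \<Rightarrow> (nat \<Rightarrow> real) \<Rightarrow> (nat \<Rightarrow> real) \<Rightarrow> bool" where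
  "stepsize_rule b L \<eta> \<longleftrightarrow>
     ereal (\<eta> 2) = min (ereal ((1 - b) * \<eta> 1)) (1 / ereal (4 * L 1)) \<and>
     ereal (\<eta> 3) = min (ereal (\<eta> 2)) (1 / ereal (4 * L 2)) \<and>
     (\<forall>t\<ge>4. ereal (\<eta> t) =
        min (ereal (real t / (real t - 1) * \<eta> (t - 1)))
            (ereal (real t - 1) / ereal (8 * L (t - 1))))"

definition avg_iterate ::
    "(nat \<Rightarrow> real) \<Rightarrow> (nat \<Rightarrow> real) \<Rightarrow> (nat \<Rightarrow> real ^ 'n) \<Rightarrow> nat \<Rightarrow> real ^ 'n" where
  "avg_iterate \<eta> \<tau> x k = (1 / (\<Sum>t=2..k+1. \<eta> t)) *\<^sub>R
     ((\<Sum>t=1..k-1. ((\<tau> t + 1) * \<eta> (t + 1) - \<tau> (t + 1) * \<eta> (t + 2)) *\<^sub>R x t)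
      + ((\<tau> k + 1) * \<eta> (k + 1)) *\<^sub>R x k)"

end

theory Submission
  imports Defs
begin

text \<open>The optimality conditions of two consecutive prox steps, combined with the definition of
  \<open>x\<^sub>t\<close> and convexity, bound the weighted increase of the gap \<open>\<Psi>(x\<^sub>t) - \<Psi>(x\<^sup>*)\<close> by the decrease of
  \<open>\<parallel>y\<^sub>t - x\<^sup>*\<parallel>\<^sup>2 / (2\<beta>)\<close> plus an error consisting of a cross term between consecutive prox displacements,
  the product of a gradient difference with \<open>z\<^sub>t - z\<^sub>t\<^sub>+\<^sub>1\<close>, and a negative Bregman gap.
  Since \<open>\<parallel>g(x\<^sub>t) - g(x\<^sub>t\<^sub>-\<^sub>1)\<parallel>\<^sup>2 = 2 L\<^sub>t B\<^sub>t\<close> even when \<open>B\<^sub>t = 0\<close>, the bound \<open>\<eta>\<^sub>t\<^sub>+\<^sub>1 L\<^sub>t \<le> \<tau>\<^sub>t / 4\<close> lets the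
  Bregman gap absorb the gradient term up to \<open>\<parallel>z\<^sub>t - z\<^sub>t\<^sub>+\<^sub>1\<parallel>\<^sup>2 / 8\<close>, and what remains is at most the decrease of
  the potential \<open>\<parallel>y\<^sub>t - z\<^sub>t\<^sub>+\<^sub>1\<parallel>\<^sup>2 / 4\<close>. Everything telescopes; the first step, where \<open>y\<^sub>0 = y\<^sub>1 = z\<^sub>0\<close>,
  contributes the term with \<open>\<parallel>z\<^sub>1 - z\<^sub>0\<parallel>\<^sup>2\<close>.\<close>

section \<open>Single-step inequalities: prox optimality, descent and control of the error\<close>

lemma power2_norm_diff_scaleR:
  fixes p q :: "'a::real_inner"
  shows "(norm (p - s *\<^sub>R q))\<^sup>2 = (norm p)\<^sup>2 - 2 * s * (p \<bullet> q) + s\<^sup>2 * (norm q)\<^sup>2"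
  unfolding power2_norm_eq_inner
  by (simp add: inner_diff_left inner_diff_right inner_commute algebra_simps power2_eq_square)

text \<open>Minimality of \<open>z\<close> is tested along the segment from \<open>z\<close> to
  \<open>u\<close>. Convexity of \<open>h\<close> leaves a linear plus a quadratic term in the
  segment parameter \<open>s\<close>; dividing by \<open>s\<close> and letting \<open>s\<close> tend
  to 0 removes the quadratic one.\<close>

lemma prox_optimality:
  fixes g y z u :: "'a::real_inner"
  assumes "convex_on X h" and u: "u \<in> X"
    and min: "is_arg_min (\<lambda>u. c * (g \<bullet> u + h u) + 1 / 2 * (norm (y - u))\<^sup>2) (\<lambda>u. u \<in> X) z"
    and c: "0 < c"
  shows "c * (g \<bullet> (z - u) + h z - h u) \<le> (y - z) \<bullet> (z - u)"
proof -
  define A where "A = c * (g \<bullet> (u - z) + h u - h z) - (y - z) \<bullet> (u - z)"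
  define S where "S = (norm (u - z))\<^sup>2 / 2"
  have z: "z \<in> X" using min by (simp add: is_arg_min_def)
  have "- (s * S) \<le> A" if s: "0 < s" "s < 1" for s :: real
  proof -
    define w where "w = (1 - s) *\<^sub>R z + s *\<^sub>R u"
    have w: "w \<in> X" unfolding w_def
      using convex_onD[OF assms(1)] convex_on_imp_convex[OF assms(1)] u z s
      by (simp add: convex_alt)
    have hw: "h w \<le> (1 - s) * h z + s * h u"
      unfolding w_def using convex_onD[OF assms(1), of s z u] u z s by simp
    have "c * (g \<bullet> z + h z) + 1 / 2 * (norm (y - z))\<^sup>2
        \<le> c * (g \<bullet> w + h w) + 1 / 2 * (norm (y - w))\<^sup>2"
      using min w by (auto simp: is_arg_min_def not_less)
    also have "\<dots> \<le> c * (g \<bullet> w + ((1 - s) * h z + s * h u)) + 1 / 2 * (norm (y - w))\<^sup>2"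
      using hw c by simp
    also have "g \<bullet> w = g \<bullet> z + s * (g \<bullet> (u - z))"
      by (simp add: w_def algebra_simps)
    also have "y - w = (y - z) - s *\<^sub>R (u - z)"
      by (simp add: w_def algebra_simps)
    also have "(norm ((y - z) - s *\<^sub>R (u - z)))\<^sup>2
        = (norm (y - z))\<^sup>2 - 2 * s * ((y - z) \<bullet> (u - z)) + s\<^sup>2 * (norm (u - z))\<^sup>2"
      by (rule power2_norm_diff_scaleR)
    finally have "0 \<le> s * (A + s * S)"
      by (simp add: A_def S_def algebra_simps power2_eq_square)
    then show ?thesis using s by (simp add: zero_le_mult_iff)
  qed
  then have "\<forall>\<^sub>F s in at_right 0. - (s * S) \<le> A"
    by (auto simp: eventually_at_right[OF zero_less_one] intro!: exI[of _ 1])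
  moreover have "((\<lambda>s. - (s * S)) \<longlongrightarrow> - (0 * S)) (at_right 0)"
    by (intro tendsto_intros)
  ultimately have "0 \<le> A"
    using tendsto_upperbound[of "\<lambda>s. - (s * S)" "- (0 * S)" "at_right 0" A] by simp
  then show ?thesis
    by (simp add: A_def inner_diff_right algebra_simps)
qed

text \<open>For iteration \<open>t\<close>, primes advance the index: \<open>x\<close>,
  \<open>x'\<close> are \<open>x\<^sub>t\<^sub>-\<^sub>1\<close>, \<open>x\<^sub>t\<close>;
  \<open>z\<close>, \<open>z'\<close> are \<open>z\<^sub>t\<close>,
  \<open>z\<^sub>t\<^sub>+\<^sub>1\<close>; \<open>y\<close>, \<open>y'\<close>, \<open>y''\<close>
  start at \<open>y\<^sub>t\<^sub>-\<^sub>1\<close>; \<open>c\<close>, \<open>c'\<close> are the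
  stepsizes of \<open>z\<close>, \<open>z'\<close>. The earlier prox step is tested at
  \<open>z'\<close> and the later one at \<open>u\<close>, so that \<open>h z'\<close> cancels in
  the sum.\<close>

lemma accelerated_step:
  fixes g g' x x' z z' y y' y'' u :: "'a::real_inner"
  assumes "convex_on X h" and X: "x \<in> X" "z \<in> X" "u \<in> X" "z' \<in> X"
    and prox: "\<And>v. v \<in> X \<Longrightarrow> c * (g \<bullet> (z - v) + h z - h v) \<le> (y - z) \<bullet> (z - v)"
    and prox': "\<And>v. v \<in> X \<Longrightarrow> c' * (g' \<bullet> (z' - v) + h z' - h v) \<le> (y' - z') \<bullet> (z' - v)"
    and c: "0 < c" "0 < c'" and b: "0 < b" and s: "0 \<le> s"
    and y'': "y'' = (1 - b) *\<^sub>R y' + b *\<^sub>R z'"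
    and x': "x' = (1 / (1 + s)) *\<^sub>R (z + s *\<^sub>R x)"
    and sub: "f x' + g' \<bullet> (u - x') \<le> f u"
  shows "c' * ((1 + s) * (f x' + h x' - (f u + h u)) - s * (f x + h x - (f u + h u)))
      + (norm (y'' - u))\<^sup>2 / (2 * b)
    \<le> (norm (y' - u))\<^sup>2 / (2 * b) - (1 - b / 2) * (norm (y' - z'))\<^sup>2
      + c' / c * ((y - z) \<bullet> (z - z')) + c' * ((g' - g) \<bullet> (z - z'))
      - c' * s * (f x - f x' - g' \<bullet> (x - x'))"
proof -
  have hx': "(1 + s) * h x' \<le> h z + s * h x"
  proof -
    have "x' = (1 - s / (1 + s)) *\<^sub>R z + (s / (1 + s)) *\<^sub>R x"
      unfolding x' using s by (simp add: algebra_simps divide_simps)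
    moreover have "s / (1 + s) \<le> 1" using s by simp
    ultimately have "h x' \<le> (1 - s / (1 + s)) * h z + (s / (1 + s)) * h x"
      using convex_onD[OF assms(1), of "s / (1 + s)" z x] X s by simp
    also have "1 - s / (1 + s) = 1 / (1 + s)" using s by (simp add: field_simps)
    finally have "h x' \<le> (h z + s * h x) / (1 + s)" by (simp add: add_divide_distrib)
    then show ?thesis using s by (simp add: pos_le_divide_eq mult.commute)
  qed
  \<comment> \<open>Written as an extrapolation, \<open>z\<close> splits
    \<open>g' \<bullet> (z - u)\<close> into a part bounding \<open>f x' - f u\<close> and a part
    along \<open>x' - x\<close> that yields the Bregman gap.\<close>
  have z: "z = x' + s *\<^sub>R (x' - x)"
  proof -
    have "z + s *\<^sub>R x = (1 + s) *\<^sub>R x'" using s by (simp add: x')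
    then show ?thesis by (simp add: algebra_simps)
  qed
  have P: "c' * (g \<bullet> (z - z') + h z - h z') \<le> c' / c * ((y - z) \<bullet> (z - z'))"
  proof -
    have "c' / c * (c * (g \<bullet> (z - z') + h z - h z')) \<le> c' / c * ((y - z) \<bullet> (z - z'))"
      using c by (intro mult_left_mono prox X) auto
    then show ?thesis using c by simp
  qed
  have split: "g' \<bullet> (z' - u) = - ((g' - g) \<bullet> (z - z')) - g \<bullet> (z - z') + g' \<bullet> (x' - u)
      + s * (g' \<bullet> (x' - x))"
  proof -
    have "g' \<bullet> (z' - u) = g' \<bullet> (z' - z) + g' \<bullet> (z - u)" by (simp add: inner_diff_right)
    also have "g' \<bullet> (z - u) = g' \<bullet> (x' - u) + s * (g' \<bullet> (x' - x))"
      by (subst z) (simp add: inner_diff_right inner_add_right algebra_simps)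
    finally show ?thesis by (simp add: inner_diff_right inner_diff_left)
  qed
  have sq: "(norm (y'' - u))\<^sup>2 = (norm (y' - u))\<^sup>2 - 2 * b * ((y' - z') \<bullet> (z' - u))
      - b * (2 - b) * (norm (y' - z'))\<^sup>2"
  proof -
    have "y'' - u = (1 - b) *\<^sub>R (y' - z') + (z' - u)" "y' - u = (y' - z') + (z' - u)"
      by (simp_all add: y'' algebra_simps)
    then show ?thesis
      unfolding power2_norm_eq_inner
      by (simp add: inner_add_left inner_add_right inner_commute algebra_simps power2_eq_square
          del: add_diff_eq diff_add_cancel add_diff_cancel)
  qed
  have "c' * ((1 + s) * (f x' + h x' - (f u + h u)) - s * (f x + h x - (f u + h u)))
      = c' * (f x' - f u + s * (f x' - f x)) + c' * ((1 + s) * h x' - s * h x - h u)"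
    by (simp add: algebra_simps)
  also have "\<dots> \<le> c' * (g' \<bullet> (x' - u) + s * (f x' - f x)) + c' * (h z - h u)"
    using sub hx' c s by (intro add_mono mult_left_mono) (auto simp: inner_diff_right)
  also have "\<dots> = c' * (g' \<bullet> (z' - u) + h z' - h u) + c' * (g \<bullet> (z - z') + h z - h z')
      + c' * ((g' - g) \<bullet> (z - z')) - c' * s * (f x - f x' - g' \<bullet> (x - x'))"
    unfolding split by (simp add: algebra_simps inner_diff_right)
  also have "\<dots> \<le> (y' - z') \<bullet> (z' - u) + c' / c * ((y - z) \<bullet> (z - z'))
      + c' * ((g' - g) \<bullet> (z - z')) - c' * s * (f x - f x' - g' \<bullet> (x - x'))"
    using prox'[OF X(3)] P by simp
  also have "(y' - z') \<bullet> (z' - u) = (norm (y' - u))\<^sup>2 / (2 * b) - (norm (y'' - u))\<^sup>2 / (2 * b)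
      - (1 - b / 2) * (norm (y' - z'))\<^sup>2"
    unfolding sq using b by (simp add: field_simps)
  finally show ?thesis by simp
qed

text \<open>Here \<open>v = y\<^sub>t\<^sub>-\<^sub>1 - z\<^sub>t\<close>, \<open>a = y\<^sub>t - z\<^sub>t\<^sub>+\<^sub>1\<close>, \<open>r = \<eta>\<^sub>t\<^sub>+\<^sub>1 / \<eta>\<^sub>t\<close>, \<open>s = \<tau>\<^sub>t\<close>, and
  \<open>a - (1 - b) v = z\<^sub>t - z\<^sub>t\<^sub>+\<^sub>1\<close>.\<close>

lemma step_error_bound:
  fixes v a D :: "'a::real_inner"
  assumes b: "0 < b" "b \<le> 1 / 5" and r: "0 \<le> r" "r \<le> 2 * (1 - b)\<^sup>2"
    and c: "0 \<le> c" "c * l \<le> s / 4" and D: "(norm D)\<^sup>2 = 2 * l * B" "0 \<le> B"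
  shows "r * (v \<bullet> (a - (1 - b) *\<^sub>R v)) + c * (D \<bullet> (a - (1 - b) *\<^sub>R v)) - c * s * B
    \<le> (1 - b / 2) * (norm a)\<^sup>2 + (norm v)\<^sup>2 / 4 - (norm a)\<^sup>2 / 4"
proof -
  define p where "p = (1 - b) *\<^sub>R v"
  \<comment> \<open>With this scaling, polarization turns the cross term into
    \<open>q * (A - P - S)\<close>, and the bound on \<open>r\<close> becomes
    \<open>q \<le> 1 - b\<close>.\<close>
  define q where "q = r / (2 * (1 - b))"
  define A P S where "A = (norm a)\<^sup>2" and "P = (norm p)\<^sup>2" and "S = (norm (a - p))\<^sup>2"
  have q: "0 \<le> q" "q \<le> 1 - b"
    using b r by (simp_all add: q_def pos_divide_le_eq power2_eq_square mult_ac)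
  \<comment> \<open>Young's inequality with weight \<open>4 * c\<close>: the hypothesis
    \<open>c * l \<le> s / 4\<close> turns the resulting \<open>32 * c\<^sup>2 * l * B\<close> into
    at most \<open>8 * c * s * B\<close>.\<close>
  have grad: "c * (D \<bullet> (a - p)) - c * s * B \<le> S / 8"
  proof -
    have "0 \<le> (norm ((a - p) - (4 * c) *\<^sub>R D))\<^sup>2" by simp
    also have "\<dots> = S - 8 * c * (D \<bullet> (a - p)) + 16 * c\<^sup>2 * (2 * l * B)"
      unfolding power2_norm_diff_scaleR S_def D(1)
      by (simp add: inner_commute power_mult_distrib)
    also have "16 * c\<^sup>2 * (2 * l * B) = 32 * (c * B) * (c * l)"
      by (simp add: power2_eq_square)
    also have "\<dots> \<le> 32 * (c * B) * (s / 4)"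
      using c D(2) by (intro mult_left_mono) auto
    finally show ?thesis by (simp add: algebra_simps)
  qed
  have inner: "r * (v \<bullet> (a - p)) = q * (A - P - S)"
  proof -
    have "q * (A - P - S) = 2 * q * (p \<bullet> (a - p))"
      unfolding A_def P_def S_def power2_norm_eq_inner
      by (simp add: inner_diff_left inner_diff_right inner_commute algebra_simps)
    also have "\<dots> = 2 * q * (1 - b) * (v \<bullet> (a - p))" by (simp add: p_def)
    also have "2 * q * (1 - b) = r" using b by (simp add: q_def field_simps)
    finally show ?thesis by simp
  qed
  have S0: "0 \<le> A" "0 \<le> P" "0 \<le> S" by (simp_all add: A_def P_def S_def)
  have par: "S \<le> 2 * A + 2 * P" "A \<le> 2 * S + 2 * P"
  proof -
    have "S + (norm (a + p))\<^sup>2 = 2 * A + 2 * P" "A + (norm (a - 2 *\<^sub>R p))\<^sup>2 = 2 * S + 2 * P"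
      unfolding A_def P_def S_def power2_norm_eq_inner
      by (simp_all add: inner_diff_left inner_diff_right inner_add_left inner_add_right
          inner_commute algebra_simps)
    then show "S \<le> 2 * A + 2 * P" "A \<le> 2 * S + 2 * P"
      by (smt (verit) zero_le_power2)+
  qed
  \<comment> \<open>The left-hand side is affine in \<open>q\<close>, so it suffices to check \<open>q = 0\<close> and \<open>q = 1 - b\<close>.\<close>
  define R where "R = S / 8 - (1 - b / 2) * A + A / 4 - P / 4"
  have "q * (A - P - S) + R \<le> 0"
  proof -
    define k Y where "k = q / (1 - b)" and "Y = A - P - S"
    have k: "0 \<le> k" "k \<le> 1" "q = k * (1 - b)" using q b by (simp_all add: k_def)
    have 0: "R \<le> 0"
      using par(1) mult_right_mono[OF b(2) S0(1)] S0 by (simp add: R_def algebra_simps)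
    \<comment> \<open>Here \<open>A\<close> has coefficient \<open>1/4 - b/2\<close>; the second
      parallelogram bound shifts it onto \<open>S\<close> and \<open>P\<close>, whose coefficients
      \<open>-(7/8 - b)\<close> and \<open>-(5/4 - b)\<close> outweigh it.\<close>
    have 1: "(1 - b) * Y + R \<le> 0"
      using par(2) mult_right_mono[OF b(2) S0(1)] mult_right_mono[OF b(2) S0(2)]
        mult_right_mono[OF b(2) S0(3)] mult_nonneg_nonneg[OF less_imp_le[OF b(1)] S0(1)] S0
      by (simp add: R_def Y_def algebra_simps)
    have "q * Y + R = (1 - k) * R + k * ((1 - b) * Y + R)"
      by (simp add: k(3) algebra_simps)
    also have "\<dots> \<le> 0"
      by (rule add_nonpos_nonpos; rule mult_nonneg_nonpos) (use k 0 1 in auto)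
    finally show ?thesis by (simp add: Y_def)
  qed
  moreover have "P \<le> (norm v)\<^sup>2"
  proof -
    have "(1 - b)\<^sup>2 \<le> 1" using b by (simp add: power_le_one)
    then have "(1 - b)\<^sup>2 * (norm v)\<^sup>2 \<le> 1 * (norm v)\<^sup>2" by (intro mult_right_mono) auto
    then show ?thesis by (simp add: P_def p_def power_mult_distrib)
  qed
  ultimately show ?thesis
    using grad inner by (simp add: p_def A_def R_def)
qed

text \<open>Here \<open>e = y\<^sub>0 - z\<^sub>1\<close> and
  \<open>a = y\<^sub>1 - z\<^sub>2\<close>, so \<open>y\<^sub>1 = y\<^sub>0\<close> gives
  \<open>z\<^sub>1 - z\<^sub>2 = a - e\<close>. As \<open>\<tau> 1 = 0\<close>, no Bregman gap is
  available; Cauchy-Schwarz with the Lipschitz ratio \<open>l\<close> replaces it, at the price of a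
  term in \<open>norm e\<close>.\<close>

lemma first_step_error_bound:
  fixes e a D :: "'a::real_inner"
  assumes b: "0 < b" and r: "0 \<le> r" "r \<le> 1 - b"
    and c: "0 \<le> c" "c * l \<le> 1 / 4" and l: "0 \<le> l" and D: "norm D = l * norm e"
  shows "r * (e \<bullet> (a - e)) + c * (D \<bullet> (a - e))
    \<le> (1 - b / 2) * (norm a)\<^sup>2 + (5 * (c * l) / 4 - r / 2) * (norm e)\<^sup>2 - (norm a)\<^sup>2 / 4"
proof -
  have "D \<bullet> (a - e) \<le> norm D * norm (a - e)" by (rule norm_cauchy_schwarz)
  also have "\<dots> \<le> l * norm e * (norm a + norm e)"
    unfolding D using l by (intro mult_left_mono norm_triangle_ineq4) auto
  also have "\<dots> = l * (norm e * norm a + (norm e)\<^sup>2)"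
    by (simp add: algebra_simps power2_eq_square)
  also have "\<dots> \<le> l * (5 / 4 * (norm e)\<^sup>2 + (norm a)\<^sup>2)"
  proof -
    have "0 \<le> (norm e / 2 - norm a)\<^sup>2" by simp
    then show ?thesis
      using l by (intro mult_left_mono) (auto simp: power2_eq_square algebra_simps)
  qed
  finally have "c * (D \<bullet> (a - e)) \<le> c * (l * (5 / 4 * (norm e)\<^sup>2 + (norm a)\<^sup>2))"
    using c by (intro mult_left_mono) auto
  also have "\<dots> = 5 * (c * l) / 4 * (norm e)\<^sup>2 + c * l * (norm a)\<^sup>2"
    by (simp add: algebra_simps)
  also have "c * l * (norm a)\<^sup>2 \<le> 1 / 4 * (norm a)\<^sup>2"
    using c by (intro mult_right_mono) auto
  finally have 1: "c * (D \<bullet> (a - e)) \<le> 5 * (c * l) / 4 * (norm e)\<^sup>2 + 1 / 4 * (norm a)\<^sup>2" by simp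
  have "2 * (e \<bullet> (a - e)) = (norm a)\<^sup>2 - (norm e)\<^sup>2 - (norm (a - e))\<^sup>2"
    unfolding power2_norm_eq_inner
    by (simp add: inner_diff_left inner_diff_right inner_commute algebra_simps)
  then have "2 * (e \<bullet> (a - e)) \<le> (norm a)\<^sup>2 - (norm e)\<^sup>2" by simp
  then have "r * (2 * (e \<bullet> (a - e))) \<le> r * ((norm a)\<^sup>2 - (norm e)\<^sup>2)"
    using r by (intro mult_left_mono) auto
  moreover have "r * (norm a)\<^sup>2 \<le> (1 - b) * (norm a)\<^sup>2"
    using r by (intro mult_right_mono) auto
  ultimately have "r * (e \<bullet> (a - e)) \<le> (1 - b) / 2 * (norm a)\<^sup>2 - r / 2 * (norm e)\<^sup>2"
    by (simp add: algebra_simps)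
  \<comment> \<open>The coefficients of \<open>(norm a)\<^sup>2\<close> fit exactly:
    \<open>1/4 + (1 - b)/2 = (1 - b/2) - 1/4\<close>.\<close>
  with 1 show ?thesis by (simp add: algebra_simps)
qed

section \<open>Feasibility of the iterates and the telescoped gap bound\<close>

lemma ac_fgm_mem:
  assumes "ac_fgm X h g \<eta> \<beta> \<tau> z y x" and X: "convex X" and \<tau>: "\<And>t. 1 \<le> t \<Longrightarrow> 0 \<le> \<tau> t"
  shows "1 \<le> t \<Longrightarrow> z t \<in> X" and "x t \<in> X"
proof -
  show z: "z t \<in> X" if "1 \<le> t" for t
    using assms(1) that by (auto simp: ac_fgm_def is_arg_min_def)
  show "x t \<in> X"
  proof (induction t)
    case 0
    then show ?case using assms(1) by (simp add: ac_fgm_def)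
  next
    case (Suc t)
    let ?s = "\<tau> (Suc t)"
    have s: "0 \<le> ?s" by (simp add: \<tau>)
    have "x (Suc t) = (1 / (1 + ?s)) *\<^sub>R z (Suc t) + (?s / (1 + ?s)) *\<^sub>R x t"
      using assms(1) by (simp add: ac_fgm_def scaleR_add_right)
    then show ?case
      using s convexD[OF X z[of "Suc t"] Suc, of "1 / (1 + ?s)" "?s / (1 + ?s)"]
      by (simp add: add_divide_distrib[symmetric])
  qed
qed

lemma bregman_gap_nonneg:
  assumes "\<forall>u\<in>X. g u \<in> subdifferential X f u" "u \<in> X" "v \<in> X"
  shows "0 \<le> bregman_gap f g u v"
proof -
  have "f u + g u \<bullet> (v - u) \<le> f v" using assms by (simp add: subdifferential_def)
  then show ?thesis by (simp add: bregman_gap_def)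
qed

text \<open>The parameters enter only through the inequalities that the two error bounds require.
  The weight of \<open>G t\<close> collects \<open>(\<tau> t + 1) * \<eta> (t + 1)\<close> from one
  step and \<open>- \<tau> (t + 1) * \<eta> (t + 2)\<close> from the next.\<close>

lemma ac_fgm_gap_bound:
  assumes h: "convex_on X h" and run: "ac_fgm X h g \<eta> \<beta> \<tau> z y x"
    and grad: "\<forall>u\<in>X. g u \<in> subdifferential X f u"
    and \<eta>: "\<And>t. 1 \<le> t \<Longrightarrow> 0 < \<eta> t" and \<tau>: "\<tau> 1 = 0" "\<And>t. 1 \<le> t \<Longrightarrow> 0 \<le> \<tau> t"
    and \<beta>: "\<beta> 1 = 0" "\<And>t. 2 \<le> t \<Longrightarrow> \<beta> t = b" and b: "0 < b" "b \<le> 1 / 5"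
    and \<eta>2: "\<eta> 2 \<le> (1 - b) * \<eta> 1"
    and ratio: "\<And>t. 2 \<le> t \<Longrightarrow> \<eta> (t + 1) \<le> 2 * (1 - b)\<^sup>2 * \<eta> t"
    and L1: "0 \<le> L 1" "\<eta> 2 * L 1 \<le> 1 / 4" "norm (g (x 1) - g (x 0)) = L 1 * norm (x 1 - x 0)"
    and L: "\<And>t. 2 \<le> t \<Longrightarrow> \<eta> (t + 1) * L t \<le> \<tau> t / 4"
      "\<And>t. 2 \<le> t \<Longrightarrow>
        (norm (g (x t) - g (x (t - 1))))\<^sup>2 = 2 * L t * bregman_gap f g (x t) (x (t - 1))"
    and u: "u \<in> X" and k: "1 \<le> k"
  defines "G \<equiv> \<lambda>t. f (x t) + h (x t) - (f u + h u)"
  shows "(\<Sum>t=1..<k. ((\<tau> t + 1) * \<eta> (t + 1) - \<tau> (t + 1) * \<eta> (t + 2)) * G t)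
      + (\<tau> k + 1) * \<eta> (k + 1) * G k
    \<le> (norm (z 0 - u))\<^sup>2 / (2 * b)
      + (5 * (\<eta> 2 * L 1) / 4 - \<eta> 2 / \<eta> 1 / 2) * (norm (z 1 - z 0))\<^sup>2"
proof -
  have X: "convex X" using h by (rule convex_on_imp_convex)
  have mem: "1 \<le> t \<Longrightarrow> z t \<in> X" "x t \<in> X" for t
    using ac_fgm_mem[OF run X] \<tau>(2) by blast+
  define a where "a t = y t - z (t + 1)" for t
  have y: "y (t + 1) = (1 - \<beta> (t + 1)) *\<^sub>R y t + \<beta> (t + 1) *\<^sub>R z (t + 1)" for t
    using run by (simp add: ac_fgm_def)
  have prox: "\<eta> (t + 1) * (g (x t) \<bullet> (z (t + 1) - v) + h (z (t + 1)) - h v)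
      \<le> (y t - z (t + 1)) \<bullet> (z (t + 1) - v)" if "v \<in> X" for t v
  proof (rule prox_optimality[OF h that])
    have "is_arg_min
          (\<lambda>u. \<eta> (t + 1) * (g (x (t + 1 - 1)) \<bullet> u + h u) + 1 / 2 * (norm (y (t + 1 - 1) - u))\<^sup>2)
          (\<lambda>u. u \<in> X) (z (t + 1))"
      using run le_add2[of 1 t] unfolding ac_fgm_def by blast
    then show "is_arg_min
          (\<lambda>u. \<eta> (t + 1) * (g (x t) \<bullet> u + h u) + 1 / 2 * (norm (y t - u))\<^sup>2)
          (\<lambda>u. u \<in> X) (z (t + 1))" by simp
  qed (simp add: \<eta>)
  have step: "\<eta> (t + 2) * ((1 + \<tau> (t + 1)) * G (t + 1) - \<tau> (t + 1) * G t)
      + (norm (y (t + 2) - u))\<^sup>2 / (2 * b)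
    \<le> (norm (y (t + 1) - u))\<^sup>2 / (2 * b) - (1 - b / 2) * (norm (a (t + 1)))\<^sup>2
      + \<eta> (t + 2) / \<eta> (t + 1) * (a t \<bullet> (z (t + 1) - z (t + 2)))
      + \<eta> (t + 2) * ((g (x (t + 1)) - g (x t)) \<bullet> (z (t + 1) - z (t + 2)))
      - \<eta> (t + 2) * \<tau> (t + 1) * bregman_gap f g (x (t + 1)) (x t)" for t
  proof -
    have "f (x (t + 1)) + g (x (t + 1)) \<bullet> (u - x (t + 1)) \<le> f u"
      using grad mem(2) u by (auto simp: subdifferential_def)
    moreover have "x (t + 1) = (1 / (1 + \<tau> (t + 1))) *\<^sub>R (z (t + 1) + \<tau> (t + 1) *\<^sub>R x t)"
      using run by (simp add: ac_fgm_def)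
    moreover have "y (t + 2) = (1 - b) *\<^sub>R y (t + 1) + b *\<^sub>R z (t + 2)"
      using y[of "t + 1"] \<beta>(2)[of "t + 2"] by (simp add: numeral_2_eq_2)
    moreover have "\<eta> (t + 2) * (g (x (t + 1)) \<bullet> (z (t + 2) - v) + h (z (t + 2)) - h v)
        \<le> (y (t + 1) - z (t + 2)) \<bullet> (z (t + 2) - v)" if "v \<in> X" for v
      using prox[of v "t + 1"] that by (simp add: numeral_2_eq_2)
    ultimately show ?thesis
      using accelerated_step[OF h mem(2)[of t] mem(1)[of "t + 1"] u mem(1)[of "t + 2"],
          of "\<eta> (t + 1)" "g (x t)" "y t" "\<eta> (t + 2)" "g (x (t + 1))" "y (t + 1)"
          b "\<tau> (t + 1)" "y (t + 2)" "x (t + 1)" f] prox[of _ t] \<eta>[of "t + 1"] \<eta>[of "t + 2"] \<tau>(2)[of "t + 1"] b(1)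
      by (simp add: G_def a_def bregman_gap_def numeral_2_eq_2)
  qed
  let ?S = "\<lambda>k. \<Sum>t=1..<k. ((\<tau> t + 1) * \<eta> (t + 1) - \<tau> (t + 1) * \<eta> (t + 2)) * G t"
  let ?E = "(norm (z 0 - u))\<^sup>2 / (2 * b)
      + (5 * (\<eta> 2 * L 1) / 4 - \<eta> 2 / \<eta> 1 / 2) * (norm (z 1 - z 0))\<^sup>2"
  \<comment> \<open>The induction carries the potential in \<open>y (k + 1)\<close> and
    \<open>a k\<close>, which is nonnegative and dropped only at the end.\<close>
  have "?S k + (\<tau> k + 1) * \<eta> (k + 1) * G k
      + ((norm (y (k + 1) - u))\<^sup>2 / (2 * b) + (norm (a k))\<^sup>2 / 4) \<le> ?E"
    using k
  proof (induction k rule: nat_induct_at_least)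
    case base
    \<comment> \<open>\<open>\<beta> 1 = 0\<close> freezes \<open>y\<close>, and
      \<open>\<tau> 1 = 0\<close> makes \<open>x 1 = z 1\<close> and removes \<open>G 0\<close> from
      the first step.\<close>
    have zy: "z 0 = x 0" "y 0 = x 0" "y 1 = x 0" "x 1 = z 1"
      using run y[of 0] \<beta>(1) \<tau>(1) by (auto simp: ac_fgm_def)
    have e: "z 1 - z 2 = a 1 - a 0"
      using a_def[of 0] a_def[of 1] unfolding zy one_add_one add_0 by simp
    have "\<eta> 2 / \<eta> 1 * (a 0 \<bullet> (a 1 - a 0)) + \<eta> 2 * ((g (x 1) - g (x 0)) \<bullet> (a 1 - a 0))
      \<le> (1 - b / 2) * (norm (a 1))\<^sup>2
        + (5 * (\<eta> 2 * L 1) / 4 - \<eta> 2 / \<eta> 1 / 2) * (norm (a 0))\<^sup>2 - (norm (a 1))\<^sup>2 / 4"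
    proof (rule first_step_error_bound)
      show "norm (g (x 1) - g (x 0)) = L 1 * norm (a 0)"
        using L1(3) unfolding zy(4) by (simp add: a_def zy(1,2) norm_minus_commute)
    qed (use b \<eta>[of 1] \<eta>[of 2] \<eta>2 L1 in \<open>auto simp: pos_divide_le_eq\<close>)
    moreover have "norm (a 0) = norm (z 1 - z 0)"
      by (simp add: a_def zy norm_minus_commute)
    ultimately show ?case
      using step[of 0] by (simp add: \<tau>[simplified] zy[simplified] e[simplified] numeral_2_eq_2[symmetric] mult.commute)
  next
    case (Suc k)
    \<comment> \<open>Since \<open>k \<ge> 1\<close>, the averaging weight at \<open>k + 1\<close>
      is \<open>b\<close>; this gives the difference of prox points the form used in
      \<open>step_error_bound\<close>.\<close>
    have "y (k + 1) - z (k + 1) = (1 - b) *\<^sub>R a k"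
      using y[of k] \<beta>(2)[of "k + 1"] Suc.hyps by (simp add: a_def algebra_simps)
    then have e: "z (k + 1) - z (k + 2) = a (k + 1) - (1 - b) *\<^sub>R a k"
      by (simp add: a_def algebra_simps numeral_2_eq_2)
    have "\<eta> (k + 2) / \<eta> (k + 1) * (a k \<bullet> (a (k + 1) - (1 - b) *\<^sub>R a k))
        + \<eta> (k + 2) * ((g (x (k + 1)) - g (x k)) \<bullet> (a (k + 1) - (1 - b) *\<^sub>R a k))
        - \<eta> (k + 2) * \<tau> (k + 1) * bregman_gap f g (x (k + 1)) (x k)
      \<le> (1 - b / 2) * (norm (a (k + 1)))\<^sup>2 + (norm (a k))\<^sup>2 / 4 - (norm (a (k + 1)))\<^sup>2 / 4"
    proof (rule step_error_bound[OF b])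
      show "(norm (g (x (k + 1)) - g (x k)))\<^sup>2
          = 2 * L (k + 1) * bregman_gap f g (x (k + 1)) (x k)"
        using L(2)[of "k + 1"] Suc.hyps by simp
      show "0 \<le> bregman_gap f g (x (k + 1)) (x k)"
        by (rule bregman_gap_nonneg[OF grad mem(2) mem(2)])
      show "\<eta> (k + 2) * L (k + 1) \<le> \<tau> (k + 1) / 4"
        using L(1)[of "k + 1"] Suc.hyps by (simp add: numeral_2_eq_2)
      show "\<eta> (k + 2) / \<eta> (k + 1) \<le> 2 * (1 - b)\<^sup>2"
        using ratio[of "k + 1"] Suc.hyps \<eta>[of "k + 1"]
        by (simp add: pos_divide_le_eq numeral_2_eq_2)
    qed (use \<eta>[of "k + 1"] \<eta>[of "k + 2"] in auto)
    then show ?case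
      using step[of k] Suc.IH Suc.hyps unfolding e by (simp add: algebra_simps)
  qed
  moreover have "0 \<le> (norm (y (k + 1) - u))\<^sup>2 / (2 * b) + (norm (a k))\<^sup>2 / 4" using b by simp
  ultimately show ?thesis by linarith
qed

section \<open>The averaged iterate\<close>

text \<open>The case split folds the boundary coefficient at \<open>k\<close> into a single weight
  function on \<open>{1..k}\<close>, the form needed for Jensen's inequality.\<close>

definition avg_weight :: "(nat \<Rightarrow> real) \<Rightarrow> (nat \<Rightarrow> real) \<Rightarrow> nat \<Rightarrow> nat \<Rightarrow> real" where
  "avg_weight \<eta> \<tau> k t = (if t < k then (\<tau> t + 1) * \<eta> (t + 1) - \<tau> (t + 1) * \<eta> (t + 2)
    else (\<tau> k + 1) * \<eta> (k + 1))"

lemma sum_avg_weight_scaleR: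
  fixes v :: "nat \<Rightarrow> 'a::real_vector"
  assumes "1 \<le> k"
  shows "(\<Sum>t=1..k. avg_weight \<eta> \<tau> k t *\<^sub>R v t)
    = (\<Sum>t=1..<k. ((\<tau> t + 1) * \<eta> (t + 1) - \<tau> (t + 1) * \<eta> (t + 2)) *\<^sub>R v t)
      + ((\<tau> k + 1) * \<eta> (k + 1)) *\<^sub>R v k"
proof -
  have "{1..k} = insert k {1..<k}" using assms by auto
  then have "(\<Sum>t=1..k. avg_weight \<eta> \<tau> k t *\<^sub>R v t)
      = avg_weight \<eta> \<tau> k k *\<^sub>R v k + (\<Sum>t=1..<k. avg_weight \<eta> \<tau> k t *\<^sub>R v t)"
    by (simp del: sum.op_ivl_Suc)
  also have "(\<Sum>t=1..<k. avg_weight \<eta> \<tau> k t *\<^sub>R v t)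
      = (\<Sum>t=1..<k. ((\<tau> t + 1) * \<eta> (t + 1) - \<tau> (t + 1) * \<eta> (t + 2)) *\<^sub>R v t)"
    by (rule sum.cong) (simp_all add: avg_weight_def)
  also have "avg_weight \<eta> \<tau> k k = (\<tau> k + 1) * \<eta> (k + 1)" by (simp add: avg_weight_def)
  finally show ?thesis by (simp only: add.commute)
qed

text \<open>The terms with \<open>\<tau>\<close> telescope, and \<open>\<tau> 1 = 0\<close> removes
  the left boundary term, so each index contributes one stepsize.\<close>

lemma sum_avg_weight:
  assumes "\<tau> 1 = 0" "1 \<le> k"
  shows "sum (avg_weight \<eta> \<tau> k) {1..k} = (\<Sum>t=2..k+1. \<eta> t)"
proof -
  have "(\<Sum>t=1..<k. (\<tau> t + 1) * \<eta> (t + 1) - \<tau> (t + 1) * \<eta> (t + 2)) + (\<tau> k + 1) * \<eta> (k + 1)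
      = (\<Sum>t=2..k+1. \<eta> t)"
    using assms(2)
  proof (induction k rule: nat_induct_at_least)
    case base
    then show ?case using assms(1) by (simp add: numeral_2_eq_2)
  next
    case (Suc k)
    then show ?case by (simp add: algebra_simps)
  qed
  then show ?thesis
    using sum_avg_weight_scaleR[OF assms(2), of \<eta> \<tau> "\<lambda>_. 1 :: real"] by simp
qed

lemma avg_iterate_jensen:
  assumes F: "convex_on X F" and x: "\<And>t. x t \<in> X" and \<tau>: "\<tau> 1 = 0" and k: "1 \<le> k"
    and w: "\<And>t. 1 \<le> t \<Longrightarrow> 0 \<le> avg_weight \<eta> \<tau> k t"
    and S: "0 < (\<Sum>t=2..k+1. \<eta> t)"
  shows "(\<Sum>t=2..k+1. \<eta> t) * (F (avg_iterate \<eta> \<tau> x k) - c)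
    \<le> (\<Sum>t=1..k. avg_weight \<eta> \<tau> k t * (F (x t) - c))"
proof -
  define W where "W = avg_weight \<eta> \<tau> k"
  define T where "T = (\<Sum>t=2..k+1. \<eta> t)"
  have T: "0 < T" using S by (simp only: T_def)
  have sumW: "sum W {1..k} = T"
    unfolding W_def T_def using \<tau> k by (rule sum_avg_weight)
  have "{1..k-1} = {1..<k}" by auto
  then have "avg_iterate \<eta> \<tau> x k = (1 / T) *\<^sub>R (\<Sum>t=1..k. W t *\<^sub>R x t)"
    unfolding avg_iterate_def W_def T_def sum_avg_weight_scaleR[OF k] by (simp only:)
  then have avg: "avg_iterate \<eta> \<tau> x k = (\<Sum>t=1..k. (W t / T) *\<^sub>R x t)"
    by (simp add: scaleR_sum_right)
  have "F (avg_iterate \<eta> \<tau> x k) \<le> (\<Sum>t=1..k. W t / T * F (x t))"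
    unfolding avg
  proof (rule convex_on_sum[OF _ _ F])
    show "(\<Sum>t=1..k. W t / T) = 1"
      using sumW T by (simp add: sum_divide_distrib[symmetric])
    show "0 \<le> W t / T" if "t \<in> {1..k}" for t
      using w[of t] T that by (simp add: W_def)
  qed (use k x in auto)
  also have "\<dots> = (\<Sum>t=1..k. W t * F (x t)) / T" by (simp add: sum_divide_distrib)
  finally have "T * F (avg_iterate \<eta> \<tau> x k) \<le> (\<Sum>t=1..k. W t * F (x t))"
    using T by (simp add: pos_le_divide_eq mult.commute)
  then have "T * (F (avg_iterate \<eta> \<tau> x k) - c) \<le> (\<Sum>t=1..k. W t * F (x t)) - sum W {1..k} * c"
    unfolding sumW by (simp add: right_diff_distrib)
  also have "\<dots> = (\<Sum>t=1..k. W t * (F (x t) - c))"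
    by (simp add: right_diff_distrib sum_subtractf sum_distrib_right)
  finally show ?thesis unfolding W_def T_def .
qed

section \<open>Stepsize rule and local estimates\<close>

text \<open>For \<open>l = 0\<close> the quotient is infinite and \<open>e = a\<close>; the product
  form \<open>e * l \<le> c\<close> covers this case without a division by zero.\<close>

lemma ereal_min_divideD:
  assumes "ereal e = min (ereal a) (ereal c / ereal l)" "0 < c" "0 \<le> l"
  shows "e \<le> a" "e * l \<le> c" "e = a \<or> 0 < l \<and> e = c / l"
proof -
  have "e = (if l = 0 then a else min a (c / l))"
    using assms by (auto simp: min_def divide_ereal_def divide_inverse split: if_splits)
  then show "e \<le> a" "e * l \<le> c" "e = a \<or> 0 < l \<and> e = c / l"
    using assms(2,3) by (auto simp: min_def field_simps split: if_splits)
qed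

lemma max_est_props:
  shows "1 / (4 * (1 - b) * e) \<le> max_est b e L t" "1 \<le> t \<Longrightarrow> L t \<le> max_est b e L t"
    "max_est b e L t \<le> max_est b e L (Suc t)"
proof -
  show "1 / (4 * (1 - b) * e) \<le> max_est b e L t" "1 \<le> t \<Longrightarrow> L t \<le> max_est b e L t"
    unfolding max_est_def by (rule Max_ge; simp)+
  show "max_est b e L t \<le> max_est b e L (Suc t)"
    unfolding max_est_def by (rule Max_mono) auto
qed

lemma stepsize_ruleD:
  assumes rule: "stepsize_rule b L \<eta>" and L: "\<forall>t\<ge>1. 0 \<le> L t"
  shows "\<eta> 2 \<le> (1 - b) * \<eta> 1" "\<eta> 2 * (4 * L 1) \<le> 1"
    "\<eta> 2 = (1 - b) * \<eta> 1 \<or> 0 < L 1 \<and> \<eta> 2 = 1 / (4 * L 1)"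
    and "\<eta> 3 \<le> \<eta> 2" "\<eta> 3 * (4 * L 2) \<le> 1" "\<eta> 3 = \<eta> 2 \<or> 0 < L 2 \<and> \<eta> 3 = 1 / (4 * L 2)"
    and "3 \<le> t \<Longrightarrow> \<eta> (t + 1) \<le> (real t + 1) / real t * \<eta> t" "3 \<le> t \<Longrightarrow> \<eta> (t + 1) * (8 * L t) \<le> real t"
    "3 \<le> t \<Longrightarrow> \<eta> (t + 1) = (real t + 1) / real t * \<eta> t \<or> 0 < L t \<and> \<eta> (t + 1) = real t / (8 * L t)"
proof -
  \<comment> \<open>\<open>one_ereal_def\<close> turns the numerator 1 into \<open>ereal 1\<close>,
    the shape expected by \<open>ereal_min_divideD\<close>.\<close>
  note r = rule[unfolded stepsize_rule_def one_ereal_def]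
  have 4: "0 \<le> 4 * L t" if "1 \<le> t" for t using L that by simp
  show "\<eta> 2 \<le> (1 - b) * \<eta> 1" "\<eta> 2 * (4 * L 1) \<le> 1"
    "\<eta> 2 = (1 - b) * \<eta> 1 \<or> 0 < L 1 \<and> \<eta> 2 = 1 / (4 * L 1)"
    using ereal_min_divideD[OF r[THEN conjunct1] zero_less_one 4] by simp_all
  show "\<eta> 3 \<le> \<eta> 2" "\<eta> 3 * (4 * L 2) \<le> 1" "\<eta> 3 = \<eta> 2 \<or> 0 < L 2 \<and> \<eta> 3 = 1 / (4 * L 2)"
    using ereal_min_divideD[OF r[THEN conjunct2, THEN conjunct1] zero_less_one 4] by simp_all
  assume t: "3 \<le> t"
  then have "ereal (\<eta> (t + 1)) =
      min (ereal ((real t + 1) / real t * \<eta> t)) (ereal (real t) / ereal (8 * L t))"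
    using r[THEN conjunct2, THEN conjunct2, rule_format, of "t + 1"]
    by (simp add: add.commute)
  from ereal_min_divideD[OF this] t L
  show "\<eta> (t + 1) \<le> (real t + 1) / real t * \<eta> t" "\<eta> (t + 1) * (8 * L t) \<le> real t"
    "\<eta> (t + 1) = (real t + 1) / real t * \<eta> t \<or> 0 < L t \<and> \<eta> (t + 1) = real t / (8 * L t)"
    by auto
qed

text \<open>Either branch of the minimum preserves the bound: the growth branch because
  \<open>max_est\<close> is nondecreasing, the quotient branch because it dominates
  \<open>L t\<close>. The constant 12 fits since \<open>(t + 1)/12\<close> is \<open>1/4\<close> at
  \<open>t = 2\<close> and at most \<open>t/8\<close> from there on.\<close>

lemma stepsize_lower_bound:
  assumes rule: "stepsize_rule b L \<eta>" and L: "\<forall>t\<ge>1. 0 \<le> L t"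
    and b: "b < 1" and \<eta>1: "0 < \<eta> 1" and t: "1 \<le> t"
  shows "0 < max_est b (\<eta> 1) L t" "(real t + 1) / (12 * max_est b (\<eta> 1) L t) \<le> \<eta> (t + 1)"
proof -
  note r = stepsize_ruleD[OF rule L]
  let ?H = "max_est b (\<eta> 1) L"
  have H0: "0 < 1 / (4 * (1 - b) * \<eta> 1)" using b \<eta>1 by simp
  have H: "0 < ?H t" for t
    using max_est_props(1)[of b "\<eta> 1" L t] H0 by linarith
  show "0 < ?H t" by (rule H)
  have quot: "c / ?H t \<le> c / L t" if "0 < L t" "1 \<le> t" "0 \<le> c" for c t
    using max_est_props(2)[OF that(2), of L b "\<eta> 1"] that by (intro divide_left_mono) auto
  have quot_Suc: "c / ?H (Suc t) \<le> c / ?H t" if "0 \<le> c" for c t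
    using max_est_props(3)[of b "\<eta> 1" L t] that H[of t] H[of "Suc t"] by (intro divide_left_mono) auto
  have 1: "1 / 4 / ?H 1 \<le> \<eta> 2"
    using r(3)
  proof
    \<comment> \<open>This branch is what the extra entry
      \<open>1 / (4 * (1 - b) * \<eta> 1)\<close> of the maximum is for.\<close>
    assume e: "\<eta> 2 = (1 - b) * \<eta> 1"
    show ?thesis
      using max_est_props(1)[of b "\<eta> 1" L 1] H[of 1] H0 b \<eta>1 unfolding e
      by (simp add: field_simps)
  next
    assume "0 < L 1 \<and> \<eta> 2 = 1 / (4 * L 1)"
    then show ?thesis using quot[of 1 "1 / 4"] by simp
  qed
  have 2: "1 / 4 / ?H 2 \<le> \<eta> 3"
    using r(6)
  proof
    assume "\<eta> 3 = \<eta> 2"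
    then show ?thesis using 1 quot_Suc[of "1 / 4" 1] by (simp add: numeral_2_eq_2)
  next
    assume "0 < L 2 \<and> \<eta> 3 = 1 / (4 * L 2)"
    then show ?thesis using quot[of 2 "1 / 4"] by simp
  qed
  have ge2: "(real t + 1) / 12 / ?H t \<le> \<eta> (t + 1)" if "2 \<le> t" for t
    using that
  proof (induction t rule: nat_induct_at_least)
    case base
    then show ?case using 2 by (simp add: numeral_2_eq_2 numeral_3_eq_3)
  next
    case (Suc t)
    let ?t = "Suc t"
    have t: "3 \<le> ?t" using Suc.hyps by simp
    show ?case
      using r(9)[OF t]
    proof
      assume e: "\<eta> (?t + 1) = (real ?t + 1) / real ?t * \<eta> ?t"
      have "(real ?t + 1) / 12 / ?H ?t \<le> (real ?t + 1) / 12 / ?H t"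
        by (rule quot_Suc) simp
      also have "\<dots> = (real ?t + 1) / real ?t * (real ?t / 12 / ?H t)"
        by (simp del: of_nat_Suc)
      also have "\<dots> \<le> (real ?t + 1) / real ?t * \<eta> ?t"
        using Suc.IH by (intro mult_left_mono) (auto simp: add.commute)
      finally show ?thesis using e by simp
    next
      assume e: "0 < L ?t \<and> \<eta> (?t + 1) = real ?t / (8 * L ?t)"
      have "(real ?t + 1) / 12 / ?H ?t \<le> real ?t / 8 / ?H ?t"
        using H[of ?t] t by (intro divide_right_mono) auto
      also have "\<dots> \<le> real ?t / 8 / L ?t"
        using e by (intro quot) auto
      finally show ?thesis using e by simp
    qed
  qed
  show "(real t + 1) / (12 * ?H t) \<le> \<eta> (t + 1)"
  proof (cases "t = 1")
    case True
    have "1 / 6 / ?H 1 \<le> 1 / 4 / ?H 1" using H[of 1] by (intro divide_right_mono) auto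
    then show ?thesis using 1 True by (simp add: numeral_2_eq_2)
  next
    case False
    then show ?thesis using ge2[of t] t by simp
  qed
qed

text \<open>The delicate case of the identity is a vanishing gap: the lower smoothness bound then
  forces the two gradients to agree.\<close>

lemma local_est_props:
  assumes grad: "\<forall>u\<in>X. g u \<in> subdifferential X f u"
    and smooth: "\<exists>M>0. smooth_with X f g M" and x: "\<And>t. x t \<in> X"
  shows "0 \<le> local_est f g x t"
    and "2 \<le> t \<Longrightarrow> (norm (g (x t) - g (x (t - 1))))\<^sup>2
      = 2 * local_est f g x t * bregman_gap f g (x t) (x (t - 1))"
proof -
  have B: "0 \<le> bregman_gap f g (x s) (x t)" for s t
    by (rule bregman_gap_nonneg[OF grad x x])
  show "0 \<le> local_est f g x t"
    using B[of t "t - 1"] by (simp add: local_est_def Let_def)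
  assume t: "2 \<le> t"
  obtain M where M: "0 < M" "smooth_with X f g M" using smooth by blast
  have "1 / (2 * M) * (norm (g (x (t - 1)) - g (x t)))\<^sup>2 \<le> bregman_gap f g (x t) (x (t - 1))"
    using M(2) x by (auto simp: smooth_with_def)
  then have "bregman_gap f g (x t) (x (t - 1)) = 0 \<Longrightarrow> g (x t) = g (x (t - 1))"
    using M(1) by (simp add: divide_le_0_iff)
  then show "(norm (g (x t) - g (x (t - 1))))\<^sup>2
      = 2 * local_est f g x t * bregman_gap f g (x t) (x (t - 1))"
    using t by (auto simp: local_est_def Let_def)
qed

section \<open>Parameter conditions and the two convergence rates\<close>

theorem corollary1:
  fixes X :: "(real ^ 'n) set"
    and f h \<Psi> :: "real ^ 'n \<Rightarrow> real"
    and g :: "real ^ 'n \<Rightarrow> real ^ 'n"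
    and x y z :: "nat \<Rightarrow> real ^ 'n"
    and \<eta> \<beta> \<tau> L Lhat :: "nat \<Rightarrow> real"
    and b :: real
  defines "\<Psi> \<equiv> \<lambda>u. f u + h u"
    and "L \<equiv> local_est f g x"
    and "Lhat \<equiv> max_est b (\<eta> 1) L"
  assumes "X \<noteq> {}" and "closed X" and "convex X"
    and "closed_convex_on X f" and "closed_convex_on X h"
    and "minimizers X \<Psi> \<noteq> {}"
    and "\<forall>u\<in>X. g u \<in> subdifferential X f u"
    and "\<exists>M>0. smooth_with X f g M"
    and "ac_fgm X h g \<eta> \<beta> \<tau> z y x"
    and "\<eta> 1 > 0" and "x 1 \<noteq> x 0"
    and "0 < b" and "b \<le> 1 - sqrt 6 / 3"
    and "\<beta> 1 = 0" and "\<forall>t\<ge>2. \<beta> t = b"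
    and "\<tau> 1 = 0" and "\<forall>t\<ge>2. \<tau> t = real t / 2"
    and "stepsize_rule b L \<eta>"
  shows "(\<forall>t\<ge>2. \<eta> t \<ge> real t / (12 * Lhat (t - 1))) \<and>
    (\<forall>xs\<in>minimizers X \<Psi>. \<forall>k\<ge>1.
       \<Psi> (x k) - \<Psi> xs \<le> 12 * Lhat k / (real k * (real k + 1)) *
         (1 / b * (norm (z 0 - xs))\<^sup>2
          + \<eta> 2 * (5 * L 1 / 2 - 1 / \<eta> 1) * (norm (z 1 - z 0))\<^sup>2) \<and>
       \<Psi> (avg_iterate \<eta> \<tau> x k) - \<Psi> xs \<le>
         1 / (\<Sum>t=2..k+1. real t / (6 * Lhat (t - 1))) *
         (1 / b * (norm (z 0 - xs))\<^sup>2
          + \<eta> 2 * (5 * L 1 / 2 - 1 / \<eta> 1) * (norm (z 1 - z 0))\<^sup>2))"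
proof -
  \<comment> \<open>Keeps the index \<open>1\<close> from becoming \<open>Suc 0\<close>, so that
    facts about \<open>x 1\<close> or \<open>\<tau> 1\<close> still match.\<close>
  note [simp del] = One_nat_def
  note grad = \<open>\<forall>u\<in>X. g u \<in> subdifferential X f u\<close>
  note run = \<open>ac_fgm X h g \<eta> \<beta> \<tau> z y x\<close>
  note rule = \<open>stepsize_rule b L \<eta>\<close>
  note \<eta>1 = \<open>\<eta> 1 > 0\<close> and b0 = \<open>0 < b\<close>
  have f: "convex_on X f" and h: "convex_on X h"
    using \<open>closed_convex_on X f\<close> \<open>closed_convex_on X h\<close> by (auto simp: closed_convex_on_def)
  have \<Psi>: "convex_on X \<Psi>" unfolding \<Psi>_def using f h by (rule convex_on_add)
  have \<tau>: "\<tau> 1 = 0" "\<And>t. 2 \<le> t \<Longrightarrow> \<tau> t = real t / 2" using assms by auto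
  have \<tau>0: "0 \<le> \<tau> t" if "1 \<le> t" for t
    using \<tau>(1) \<tau>(2)[of t] that by (cases "t = 1") simp_all
  have mem: "x t \<in> X" for t
    using ac_fgm_mem[OF run \<open>convex X\<close>] \<tau>0 by blast
  have L: "0 \<le> L t" "2 \<le> t \<Longrightarrow>
      (norm (g (x t) - g (x (t - 1))))\<^sup>2 = 2 * L t * bregman_gap f g (x t) (x (t - 1))" for t
    unfolding L_def
    by (rule local_est_props[OF grad \<open>\<exists>M>0. smooth_with X f g M\<close> mem]; assumption)+
  have L1: "norm (g (x 1) - g (x 0)) = L 1 * norm (x 1 - x 0)"
    using \<open>x 1 \<noteq> x 0\<close> by (simp add: L_def local_est_def)
  \<comment> \<open>A rational lower bound for \<open>sqrt 6\<close> that gives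
    \<open>sqrt 6 / 3 \<ge> 4 / 5\<close>.\<close>
  have "(12 / 5)\<^sup>2 \<le> (6 :: real)" by (simp add: power2_eq_square)
  then have "12 / 5 \<le> sqrt 6" by (rule real_le_rsqrt)
  then have b: "b \<le> 1 / 5" using \<open>b \<le> 1 - sqrt 6 / 3\<close> by simp
  \<comment> \<open>The range of \<open>b\<close> gives \<open>(1 - b)\<^sup>2 \<ge> 2 / 3\<close>,
    and \<open>4 / 3\<close> is the largest growth factor \<open>(t + 1) / t\<close> in the rule, at
    \<open>t = 3\<close>.\<close>
  have "(sqrt 6 / 3)\<^sup>2 \<le> (1 - b)\<^sup>2"
    using \<open>b \<le> 1 - sqrt 6 / 3\<close> by (intro power_mono) auto
  then have b2: "4 / 3 \<le> 2 * (1 - b)\<^sup>2" by (simp add: power_divide)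
  have L0: "\<forall>t\<ge>1. 0 \<le> L t" using L(1) by simp
  note r = stepsize_ruleD[OF rule L0]
  have "b < 1" using b by simp
  have H: "0 < Lhat t" "(real t + 1) / (12 * Lhat t) \<le> \<eta> (t + 1)" if "1 \<le> t" for t
    unfolding Lhat_def
    by (rule stepsize_lower_bound[OF rule L0 \<open>b < 1\<close> \<eta>1 that])+
  have \<eta>: "0 < \<eta> t" if "1 \<le> t" for t
  proof (cases "t = 1")
    case False
    with that have t: "1 \<le> t - 1" "t - 1 + 1 = t" by simp_all
    have "0 < (real (t - 1) + 1) / (12 * Lhat (t - 1))" using H(1)[OF t(1)] by simp
    then show ?thesis using H(2)[OF t(1)] unfolding t(2) by linarith
  qed (use \<eta>1 in simp)
  have lower: "real t / (12 * Lhat (t - 1)) \<le> \<eta> t" if "2 \<le> t" for t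
    using H(2)[of "t - 1"] that by (simp add: of_nat_diff)
  have ratio: "\<eta> (t + 1) \<le> 2 * (1 - b)\<^sup>2 * \<eta> t" if "2 \<le> t" for t
  proof -
    have "\<eta> (t + 1) \<le> 4 / 3 * \<eta> t"
    proof (cases "t = 2")
      case True
      then show ?thesis using r(4) \<eta>[of 2] by simp
    next
      case False
      with that have t: "3 \<le> t" by simp
      have "\<eta> (t + 1) \<le> (real t + 1) / real t * \<eta> t" by (rule r(7)[OF t])
      also have "\<dots> \<le> 4 / 3 * \<eta> t"
        using t \<eta>[of t] by (intro mult_right_mono) (auto simp: field_simps)
      finally show ?thesis .
    qed
    also have "\<dots> \<le> 2 * (1 - b)\<^sup>2 * \<eta> t"
      using b2 \<eta>[of t] that by (intro mult_right_mono) auto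
    finally show ?thesis .
  qed
  \<comment> \<open>The target \<open>\<tau> t / 4\<close> is \<open>t / 8\<close>: the constant 8
    of the rule for \<open>t \<ge> 3\<close>, and \<open>1 / 4\<close> for
    \<open>t = 2\<close>.\<close>
  have \<eta>L: "\<eta> (t + 1) * L t \<le> \<tau> t / 4" if "2 \<le> t" for t
    using r(5) r(8)[of t] \<tau>(2)[OF that] that by (cases "t = 2") auto
  \<comment> \<open>For \<open>2 \<le> t < k\<close> the growth limit fits exactly:
    \<open>\<tau> (t + 1)\<close> times \<open>(t + 2) / (t + 1)\<close> is
    \<open>\<tau> t + 1\<close>. For \<open>t = 1 < k\<close>,
    \<open>\<eta> 3 \<le> \<eta> 2\<close> suffices.\<close>
  have w: "0 \<le> avg_weight \<eta> \<tau> k t" if "1 \<le> t" "1 \<le> k" for k t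
  proof -
    have "\<tau> (t + 1) * \<eta> (t + 2) \<le> (\<tau> t + 1) * \<eta> (t + 1)"
    proof (cases "t = 1")
      case True
      then show ?thesis using r(4) \<tau>(1) \<tau>(2)[of 2] by simp
    next
      case False
      with that have t: "2 \<le> t" by simp
      have "\<eta> (t + 2) \<le> (real t + 2) / (real t + 1) * \<eta> (t + 1)"
        using r(7)[of "t + 1"] t by (simp add: add.assoc)
      then have "(real t + 1) / 2 * \<eta> (t + 2)
          \<le> (real t + 1) / 2 * ((real t + 2) / (real t + 1) * \<eta> (t + 1))"
        by (intro mult_left_mono) auto
      also have "\<dots> = (real t / 2 + 1) * \<eta> (t + 1)"
        by (simp add: divide_simps)
      also have "real t / 2 = \<tau> t" using \<tau>(2)[of t] t by simp
      also have "(real t + 1) / 2 = \<tau> (t + 1)" using \<tau>(2)[of "t + 1"] t by simp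
      finally show ?thesis .
    qed
    then show ?thesis
      using \<eta>[of "k + 1"] \<tau>0[of k] that by (simp add: avg_weight_def)
  qed
  have "\<Psi> (x k) - \<Psi> xs \<le> 12 * Lhat k / (real k * (real k + 1)) *
         (1 / b * (norm (z 0 - xs))\<^sup>2
          + \<eta> 2 * (5 * L 1 / 2 - 1 / \<eta> 1) * (norm (z 1 - z 0))\<^sup>2) \<and>
       \<Psi> (avg_iterate \<eta> \<tau> x k) - \<Psi> xs \<le>
         1 / (\<Sum>t=2..k+1. real t / (6 * Lhat (t - 1))) *
         (1 / b * (norm (z 0 - xs))\<^sup>2
          + \<eta> 2 * (5 * L 1 / 2 - 1 / \<eta> 1) * (norm (z 1 - z 0))\<^sup>2)"
    (is "?G k \<le> ?c * ?E \<and> ?A \<le> 1 / ?S * ?E")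
    if xs: "xs \<in> minimizers X \<Psi>" and k: "1 \<le> k" for xs k
  proof -
    have "xs \<in> X" using xs by (simp add: minimizers_def is_arg_min_def)
    have G: "0 \<le> ?G t" for t
      using xs mem[of t] by (auto simp: minimizers_def is_arg_min_def not_less)
    have "(\<Sum>t=1..k. avg_weight \<eta> \<tau> k t * ?G t)
      \<le> (norm (z 0 - xs))\<^sup>2 / (2 * b)
        + (5 * (\<eta> 2 * L 1) / 4 - \<eta> 2 / \<eta> 1 / 2) * (norm (z 1 - z 0))\<^sup>2"
      using ac_fgm_gap_bound[OF h run grad \<eta> \<tau>(1) \<tau>0 \<open>\<beta> 1 = 0\<close> _ b0 b r(1) ratio L(1) _ L1 \<eta>L L(2)
          \<open>xs \<in> X\<close> k] \<open>\<forall>t\<ge>2. \<beta> t = b\<close> r(2)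
        sum_avg_weight_scaleR[OF k, of \<eta> \<tau> "\<lambda>t. ?G t"]
      by (simp add: \<Psi>_def)
    also have "\<dots> = ?E / 2"
      by (simp add: field_simps)
    finally have main: "(\<Sum>t=1..k. avg_weight \<eta> \<tau> k t * ?G t) \<le> ?E / 2" .
    have nonneg: "0 \<le> avg_weight \<eta> \<tau> k t * ?G t" if "t \<in> {1..k}" for t
      using w[of t k] G[of t] that k by simp
    \<comment> \<open>The factor \<open>5 * L 1 / 2 - 1 / \<eta> 1\<close> may be negative, so the
      sign of the bracket is read off the gap sum; shrinking the denominator later relies on
      it.\<close>
    have E: "0 \<le> ?E"
      using main sum_nonneg[of "{1..k}" "\<lambda>t. avg_weight \<eta> \<tau> k t * ?G t"] nonneg by simp
    have "?G k \<le> ?c * ?E"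
    proof -
      \<comment> \<open>Uses \<open>k / 2 \<le> \<tau> k + 1\<close>, which also covers
        \<open>k = 1\<close>, where \<open>\<tau> 1 = 0\<close>.\<close>
      have "real k * (real k + 1) / (24 * Lhat k) \<le> (\<tau> k + 1) * \<eta> (k + 1)"
      proof -
        have "real k / 2 * ((real k + 1) / (12 * Lhat k)) \<le> (\<tau> k + 1) * \<eta> (k + 1)"
          using H[OF k] k \<tau>(1) \<tau>(2)[of k] \<tau>0[OF k] by (intro mult_mono) (cases "k = 1"; simp)+
        then show ?thesis by simp
      qed
      then have "real k * (real k + 1) / (24 * Lhat k) * ?G k \<le> avg_weight \<eta> \<tau> k k * ?G k"
        using G[of k] by (intro mult_right_mono) (auto simp: avg_weight_def)
      also have "\<dots> \<le> (\<Sum>t=1..k. avg_weight \<eta> \<tau> k t * ?G t)"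
        using nonneg k by (intro member_le_sum) auto
      also note main
      finally have bound: "real k * (real k + 1) / (24 * Lhat k) * ?G k \<le> ?E / 2" .
      have rearrange: "a \<le> 12 * l / m * e" if "m / (24 * l) * a \<le> e / 2" "0 < m" "0 < l"
        for a e l m :: real
        using that by (simp add: field_simps)
      from bound show ?thesis
        by (rule rearrange) (use H(1)[OF k] k in simp_all)
    qed
    moreover have "?A \<le> 1 / ?S * ?E"
    proof -
      have S0: "0 < ?S" using k H(1) by (intro sum_pos) auto
      have "?S = 2 * (\<Sum>t=2..k+1. real t / (12 * Lhat (t - 1)))"
        unfolding sum_distrib_left by (intro sum.cong) auto
      also have "\<dots> \<le> 2 * (\<Sum>t=2..k+1. \<eta> t)"
        using lower by (intro mult_left_mono sum_mono) auto
      finally have S: "?S / 2 \<le> (\<Sum>t=2..k+1. \<eta> t)" by simp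
      then have T: "0 < (\<Sum>t=2..k+1. \<eta> t)" using S0 by linarith
      have "(\<Sum>t=2..k+1. \<eta> t) * ?A \<le> ?E / 2"
        using avg_iterate_jensen[OF \<Psi> mem \<tau>(1) k w[OF _ k] T] main by (rule order_trans)
      then have "?A \<le> ?E / 2 / (\<Sum>t=2..k+1. \<eta> t)"
        using T by (simp add: pos_le_divide_eq mult.commute)
      also have "\<dots> \<le> ?E / 2 / (?S / 2)"
        using S E S0 by (intro divide_left_mono) auto
      also have "e / 2 / (s / 2) = 1 / s * e" for e s :: real by simp
      finally show ?thesis .
    qed
    ultimately show ?thesis ..
  qed
  then show ?thesis using lower by blast
qed

end
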